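(* For the pointed systems $(\mathcal M_\alpha,M_\alpha)$ ($\alpha$ an ordinal) constructed in the context, each $(\mathcal M_\alpha,M_\alpha)$ satisfies a different $L^{\Diamond}_\infty$-theory; that is, for $\alpha\ne\beta$ there is an $L^{\Diamond}_\infty$-sentence true at exactly one of $(\mathcal M_\alpha,M_\alpha)$ and $(\mathcal M_\beta,M_\beta)$. Hence the potentialist system consisting of the disjoint union of all the $\mathcal M_\alpha$ cannot be bitotally bisimilar with a set-sized potentialist system (one with only set-many worlds).
   Context: A potentialist system is a collection (possibly a proper class) of $L$-structures, called worlds, together with a collection of embeddings between them, containing the identity embeddings and closed under composition. "$\pi\colon M\to M'$ in $\mathcal M$" means that $\pi$ is one of the embeddings of $\mathcal M$. Class-sized systems are handled in a class theory such as Morse-Kelley, or by taking "set" to mean element of a fixed Grothendieck universe and "ordinal" to mean ordinal of that universe. A pointed system $(\mathcal M,M)$ (without parameters) is a system with a chosen world. Construction. Let $L=\{\approx\}$ and let $T$ be the theory saying that $\approx$ is an equivalence relation with infinitely many classes of size $1$, infinitely many classes of size $2$, and no other classes. For an ordinal $\alpha$ let $X_\alpha$ be the well-founded tree consisting of a root sitting below disjoint copies of each $X_\beta$, $\beta<\alpha$ (so nodes correspond to finite strictly decreasing sequences of ordinals less than $\alpha$, the root being the empty sequence, ordered by extension). Let $N$ be a fixed countable model of $T$. The system $\mathcal M_\alpha$ has one world for each node of $X_\alpha$, worlds at different nodes being regarded as distinct (disjoint copies where needed): the root carries $N$ together with new elements $u_0,u_1,u_2,\dots$, each in its own singleton equivalence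 class; a node at height $n$ carries this same model with additional elements $v_0,\dots,v_{n-1}$, where $v_i$ is placed in the equivalence class of $u_i$ for $i<n$. For each node $s$ below or equal to a node $t$ there is exactly one embedding in $\mathcal M_\alpha$ from the world at $s$ to the world at $t$, the natural inclusion embedding; there are no other embeddings. All worlds are countable models of $T$. $M_\alpha$ is the world at the root of $\mathcal M_\alpha$. The disjoint union of all $\mathcal M_\alpha$ has as worlds all the worlds of the $\mathcal M_\alpha$ (made distinct), with just the embeddings of each $\mathcal M_\alpha$. The language $L^{\Diamond}_\infty$: formulas built from atomic $L$-formulas by negation, conjunctions and disjunctions of arbitrary set size, the quantifiers $\exists x$, $\forall x$, and the modal operators $\Diamond,\Box$, where every formula has only finitely many free variables. Satisfaction: non-modal clauses are as usual in $M$; $\mathcal M,M\vDash\Diamond\phi[\overline a]$ iff there is $\pi\colon M\to M'$ in $\mathcal M$ with $\mathcal M,M'\vDash\phi[\pi(\overline a)]$; $\mathcal M,M\vDash\Box\phi[\overline a]$ iff for every $\pi\colon M\to M'$ in $\mathcal M$, $\mathcal M,M'\vDash\phi[\pi(\overline a)]$. A bisimulation between $\mathcal M$ and $\mathcal N$ is a non-empty relation $\sim$ matching pairs $(M,\overline a)$ with pairs $(N,\overline b)$, where $M\in\mathcal M$, $N\in\mathcal N$ and $\overline a,\overline b$ are finite tuples of the same length from $M,N$ respectively, such that whenever $(M,\overline a)\sim(N,\overline b)$: (B1) $\overline a$ in $M$ and $\overline b$ in $N$ satisfy the same atomic formulas; (B2) for any $c\in M$ there is $d\in N$ with $(M,\overline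 a c)\sim(N,\overline b d)$, and vice versa; (B3) for any $\pi\colon M\to M'$ in $\mathcal M$ there is $\rho\colon N\to N'$ in $\mathcal N$ with $(M',\pi(\overline a))\sim(N',\rho(\overline b))$, and vice versa. It is bitotal if every pair from $\mathcal M$ is related to some pair from $\mathcal N$ and every pair from $\mathcal N$ is related to some pair from $\mathcal M$; two systems are bitotally bisimilar if there is a bitotal bisimulation between them. *)

theory Defs
  imports "HOL-Library.Equipollence" "HOL-Library.Sublist" "HOL-Library.FuncSet"
    "HOL-Library.Countable_Set"
begin

text \<open>
  Sets, proper classes and ordinals. A type \<open>'o\<close> of class \<^class>\<open>wellorder\<close> plays the role of
  the class of all ordinals; it is required to be uncountable, and every single ordinal
  \<open>{..<a}\<close> has to be strictly smaller than the whole of \<open>'o\<close>. A collection is a set (is small)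
  if it is strictly smaller than \<open>'o\<close>. The intended instance is a Grothendieck universe
  \<open>V\<^sub>\<kappa>\<close>, where \<open>'o\<close> is the inaccessible cardinal \<open>\<kappa>\<close>: a subcollection of \<open>V\<^sub>\<kappa>\<close> is an
  element of \<open>V\<^sub>\<kappa>\<close> iff it has fewer than \<open>\<kappa>\<close> elements. Closure under power sets
  and regularity are not imposed, so every such universe is covered.
\<close>

definition small :: "'o itself \<Rightarrow> 'a set \<Rightarrow> bool" where
  "small _ A \<longleftrightarrow> A \<prec> (UNIV :: 'o set)"

definition class_of_ordinals :: "'o::wellorder itself \<Rightarrow> bool" where
  "class_of_ordinals k \<longleftrightarrow> uncountable (UNIV :: 'o set) \<and> (\<forall>a::'o. small k {..<a})"


text \<open>Structures for the language \<open>{\<approx>}\<close>; \<open>rel\<close> interprets \<open>\<approx>\<close>.\<close>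

record 'a struct =
  elems :: "'a set"
  rel :: "('a \<times> 'a) set"

definition is_struct :: "'a struct \<Rightarrow> bool" where
  "is_struct A \<longleftrightarrow> elems A \<noteq> {} \<and> rel A \<subseteq> elems A \<times> elems A"

text \<open>Maps are extensional, so that equality of maps is equality on the domain.\<close>

definition is_embedding :: "'a struct \<Rightarrow> 'b struct \<Rightarrow> ('a \<Rightarrow> 'b) \<Rightarrow> bool" where
  "is_embedding A B f \<longleftrightarrow>
     f \<in> elems A \<rightarrow>\<^sub>E elems B \<and> inj_on f (elems A) \<and>
     (\<forall>x\<in>elems A. \<forall>y\<in>elems A. (f x, f y) \<in> rel B \<longleftrightarrow> (x, y) \<in> rel A)"

text \<open>
  Worlds are named by elements of \<open>'w\<close>, so that distinct worlds may carry the same structure;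
  this replaces the passage to disjoint copies.
\<close>

record ('w, 'a) psystem =
  worlds :: "'w set"
  str :: "'w \<Rightarrow> 'a struct"
  embs :: "'w \<Rightarrow> 'w \<Rightarrow> ('a \<Rightarrow> 'a) set"

definition potentialist_system :: "('w, 'a) psystem \<Rightarrow> bool" where
  "potentialist_system S \<longleftrightarrow>
     (\<forall>w\<in>worlds S. is_struct (str S w)) \<and>
     (\<forall>w\<in>worlds S. \<forall>w'\<in>worlds S. \<forall>p\<in>embs S w w'. is_embedding (str S w) (str S w') p) \<and>
     (\<forall>w\<in>worlds S. restrict id (elems (str S w)) \<in> embs S w w) \<and>
     (\<forall>w\<in>worlds S. \<forall>w'\<in>worlds S. \<forall>w''\<in>worlds S. \<forall>p\<in>embs S w w'. \<forall>q\<in>embs S w' w''.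
        compose (elems (str S w)) q p \<in> embs S w w'')"

definition disjoint_union :: "('i \<Rightarrow> ('w, 'a) psystem) \<Rightarrow> ('i \<times> 'w, 'a) psystem" where
  "disjoint_union S =
     \<lparr>worlds = (SIGMA i:UNIV. worlds (S i)),
      str = (\<lambda>(i, w). str (S i) w),
      embs = (\<lambda>(i, w) (j, w'). if i = j then embs (S i) w w' else {})\<rparr>"


datatype atom = Equal nat nat | Related nat nat

primrec atom_vars :: "atom \<Rightarrow> nat set" where
  "atom_vars (Equal i j) = {i, j}"
| "atom_vars (Related i j) = {i, j}"

primrec atom_holds :: "'a struct \<Rightarrow> (nat \<Rightarrow> 'a) \<Rightarrow> atom \<Rightarrow> bool" where
  "atom_holds A e (Equal i j) \<longleftrightarrow> e i = e j"
| "atom_holds A e (Related i j) \<longleftrightarrow> (e i, e j) \<in> rel A"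

text \<open>
  \<open>Conj I f\<close> is the conjunction of the formulas \<open>f i\<close> with \<open>i \<in> I\<close>; the values of \<open>f\<close>
  outside \<open>I\<close> are irrelevant. A small family of formulas can always be indexed by a small set of
  ordinals. The datatype contains also conjunctions over large sets and formulas with
  infinitely many free variables, which \<open>is_formula\<close> rules out.
\<close>

datatype 'o fm =
    Atom atom
  | Neg "'o fm"
  | Conj "'o set" "'o \<Rightarrow> 'o fm"
  | Disj "'o set" "'o \<Rightarrow> 'o fm"
  | Exists nat "'o fm"
  | Forall nat "'o fm"
  | Dia "'o fm"
  | Box "'o fm"

primrec free_vars :: "'o fm \<Rightarrow> nat set" where
  "free_vars (Atom a) = atom_vars a"
| "free_vars (Neg p) = free_vars p"
| "free_vars (Conj I f) = (\<Union>i\<in>I. free_vars (f i))"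
| "free_vars (Disj I f) = (\<Union>i\<in>I. free_vars (f i))"
| "free_vars (Exists x p) = free_vars p - {x}"
| "free_vars (Forall x p) = free_vars p - {x}"
| "free_vars (Dia p) = free_vars p"
| "free_vars (Box p) = free_vars p"

primrec is_formula :: "'o fm \<Rightarrow> bool" where
  "is_formula (Atom a) \<longleftrightarrow> True"
| "is_formula (Neg p) \<longleftrightarrow> is_formula p"
| "is_formula (Conj I f) \<longleftrightarrow>
     small TYPE('o) I \<and> (\<forall>i\<in>I. is_formula (f i)) \<and> finite (\<Union>i\<in>I. free_vars (f i))"
| "is_formula (Disj I f) \<longleftrightarrow>
     small TYPE('o) I \<and> (\<forall>i\<in>I. is_formula (f i)) \<and> finite (\<Union>i\<in>I. free_vars (f i))"
| "is_formula (Exists x p) \<longleftrightarrow> is_formula p"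
| "is_formula (Forall x p) \<longleftrightarrow> is_formula p"
| "is_formula (Dia p) \<longleftrightarrow> is_formula p"
| "is_formula (Box p) \<longleftrightarrow> is_formula p"

definition is_sentence :: "'o fm \<Rightarrow> bool" where
  "is_sentence p \<longleftrightarrow> is_formula p \<and> free_vars p = {}"

text \<open>
  \<open>e\<close> assigns elements of the current world to the variables; only its values at the free variables
  matter.
\<close>

primrec sat :: "('w, 'a) psystem \<Rightarrow> 'w \<Rightarrow> (nat \<Rightarrow> 'a) \<Rightarrow> 'o fm \<Rightarrow> bool" where
  "sat S w e (Atom a) \<longleftrightarrow> atom_holds (str S w) e a"
| "sat S w e (Neg p) \<longleftrightarrow> \<not> sat S w e p"
| "sat S w e (Conj I f) \<longleftrightarrow> (\<forall>i\<in>I. sat S w e (f i))"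
| "sat S w e (Disj I f) \<longleftrightarrow> (\<exists>i\<in>I. sat S w e (f i))"
| "sat S w e (Exists x p) \<longleftrightarrow> (\<exists>c\<in>elems (str S w). sat S w (e(x := c)) p)"
| "sat S w e (Forall x p) \<longleftrightarrow> (\<forall>c\<in>elems (str S w). sat S w (e(x := c)) p)"
| "sat S w e (Dia p) \<longleftrightarrow> (\<exists>w'\<in>worlds S. \<exists>q\<in>embs S w w'. sat S w' (q \<circ> e) p)"
| "sat S w e (Box p) \<longleftrightarrow> (\<forall>w'\<in>worlds S. \<forall>q\<in>embs S w w'. sat S w' (q \<circ> e) p)"

definition true_at :: "('w, 'a) psystem \<Rightarrow> 'w \<Rightarrow> 'o fm \<Rightarrow> bool" where
  "true_at S w p \<longleftrightarrow> (\<forall>e. range e \<subseteq> elems (str S w) \<longrightarrow> sat S w e p)"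

definition theory_of :: "('w, 'a) psystem \<Rightarrow> 'w \<Rightarrow> 'o fm set" where
  "theory_of S w = {p. is_sentence p \<and> true_at S w p}"


definition pairs :: "('w, 'a) psystem \<Rightarrow> ('w \<times> 'a list) set" where
  "pairs S = (SIGMA w:worlds S. lists (elems (str S w)))"

definition bisimulation ::
  "('w, 'a) psystem \<Rightarrow> ('v, 'b) psystem \<Rightarrow> (('w \<times> 'a list) \<times> ('v \<times> 'b list)) set \<Rightarrow> bool" where
  "bisimulation S T R \<longleftrightarrow>
     R \<noteq> {} \<and> R \<subseteq> pairs S \<times> pairs T \<and>
     (\<forall>w as v bs. ((w, as), (v, bs)) \<in> R \<longrightarrow>
        length as = length bs \<and>
        (\<forall>a. atom_vars a \<subseteq> {..<length as} \<longrightarrow>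
           (atom_holds (str S w) ((!) as) a \<longleftrightarrow> atom_holds (str T v) ((!) bs) a)) \<and>
        (\<forall>c\<in>elems (str S w). \<exists>d\<in>elems (str T v). ((w, as @ [c]), (v, bs @ [d])) \<in> R) \<and>
        (\<forall>d\<in>elems (str T v). \<exists>c\<in>elems (str S w). ((w, as @ [c]), (v, bs @ [d])) \<in> R) \<and>
        (\<forall>w'\<in>worlds S. \<forall>p\<in>embs S w w'. \<exists>v'\<in>worlds T. \<exists>q\<in>embs T v v'.
           ((w', map p as), (v', map q bs)) \<in> R) \<and>
        (\<forall>v'\<in>worlds T. \<forall>q\<in>embs T v v'. \<exists>w'\<in>worlds S. \<exists>p\<in>embs S w w'.
           ((w', map p as), (v', map q bs)) \<in> R))"

definition bitotally_bisimilar :: "('w, 'a) psystem \<Rightarrow> ('v, 'b) psystem \<Rightarrow> bool" where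
  "bitotally_bisimilar S T \<longleftrightarrow>
     (\<exists>R. bisimulation S T R \<and> Domain R = pairs S \<and> Range R = pairs T)"


definition models_T :: "'a struct \<Rightarrow> bool" where
  "models_T A \<longleftrightarrow>
     is_struct A \<and> equiv (elems A) (rel A) \<and>
     infinite {C \<in> elems A // rel A. card C = 1} \<and>
     infinite {C \<in> elems A // rel A. card C = 2} \<and>
     (\<forall>C \<in> elems A // rel A. card C = 1 \<or> card C = 2)"

text \<open>
  The nodes of the tree \<open>X\<^sub>\<alpha>\<close>, ordered by \<^const>\<open>prefix\<close>; the root is \<open>[]\<close> and the height of a
  node is its length.
\<close>

definition tree :: "'o::wellorder \<Rightarrow> 'o list set" where
  "tree \<alpha> = {s. sorted_wrt (>) s \<and> set s \<subseteq> {..<\<alpha>}}"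

datatype 'n elt = Old 'n | U nat | V nat

definition node_struct :: "'n struct \<Rightarrow> nat \<Rightarrow> 'n elt struct" where
  "node_struct N n =
     \<lparr>elems = Old ` elems N \<union> range U \<union> V ` {..<n},
      rel = {(Old x, Old y) |x y. (x, y) \<in> rel N} \<union> {(U i, U i) |i. True} \<union>
        (\<Union>i<n. {(V i, V i), (U i, V i), (V i, U i)})\<rparr>"

definition tree_system :: "'n struct \<Rightarrow> 'o::wellorder \<Rightarrow> ('o list, 'n elt) psystem" where
  "tree_system N \<alpha> =
     \<lparr>worlds = tree \<alpha>,
      str = (\<lambda>s. node_struct N (length s)),
      embs = (\<lambda>s t. if prefix s t then {restrict id (elems (node_struct N (length s)))} else {})\<rparr>"

lemma elems_node_struct_mono: "m \<le> n \<Longrightarrow> elems (node_struct N m) \<subseteq> elems (node_struct N n)"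
  by (auto simp: node_struct_def)

lemma rel_node_struct_restrict:
  assumes "m \<le> n" "x \<in> elems (node_struct N m)" "y \<in> elems (node_struct N m)"
  shows "(x, y) \<in> rel (node_struct N n) \<longleftrightarrow> (x, y) \<in> rel (node_struct N m)"
  using assms by (auto simp: node_struct_def)

lemma countable_node_struct: "countable (elems N) \<Longrightarrow> countable (elems (node_struct N n))"
  by (simp add: node_struct_def)

lemma models_T_node_struct:
  assumes "models_T N"
  shows "models_T (node_struct N n)"
proof -
  let ?A = "node_struct N n"
  let ?E = "elems ?A" and ?R = "rel ?A"
  have eqN: "equiv (elems N) (rel N)" and subN: "rel N \<subseteq> elems N \<times> elems N"
    using assms by (auto simp: models_T_def is_struct_def)
  have struct: "is_struct ?A"
    using assms by (auto simp: models_T_def is_struct_def node_struct_def)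
  have equiv: "equiv ?E ?R"
  proof (rule equivI)
    show "?R \<subseteq> ?E \<times> ?E" using struct by (simp add: is_struct_def)
    show "refl_on ?E ?R" using eqN by (auto simp: node_struct_def equiv_def refl_on_def)
    show "sym ?R" using eqN by (auto simp: node_struct_def equiv_def sym_def)
    show "trans ?R"
      using eqN by (auto simp: node_struct_def equiv_def intro!: transI dest: transD)
  qed
  have old: "?R `` {Old x} = Old ` (rel N `` {x})" for x
    by (auto simp: node_struct_def)
  have cls_U: "?R `` {U i} = (if i < n then {U i, V i} else {U i})" for i
    by (auto simp: node_struct_def)
  have cls_V: "?R `` {V i} = {U i, V i}" if "i < n" for i
    using that by (auto simp: node_struct_def)
  have card_old: "card (Old ` C) = card C" for C :: "'a set"
    by (simp add: card_image inj_on_def)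
  have quot: "(\<lambda>C. Old ` C) ` (elems N // rel N) \<subseteq> ?E // ?R"
    by (auto simp: quotient_def old[symmetric] node_struct_def)
  have inf: "infinite {C \<in> ?E // ?R. card C = k}"
    if "infinite {C \<in> elems N // rel N. card C = k}" for k
  proof -
    have "(\<lambda>C. Old ` C) ` {C \<in> elems N // rel N. card C = k} \<subseteq> {C \<in> ?E // ?R. card C = k}"
      using quot by (auto simp: card_old)
    moreover have "infinite ((\<lambda>C. Old ` C) ` {C \<in> elems N // rel N. card C = k})"
      using that by (subst finite_image_iff) (auto simp: inj_on_def inj_image_eq_iff)
    ultimately show ?thesis using infinite_super by blast
  qed
  have "card C = 1 \<or> card C = 2" if C: "C \<in> ?E // ?R" for C
  proof -
    obtain z where z: "z \<in> ?E" "C = ?R `` {z}" using C by (auto elim: quotientE)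
    show ?thesis
    proof (cases z)
      case (Old x)
      then have "rel N `` {x} \<in> elems N // rel N"
        using z by (auto simp: node_struct_def intro: quotientI)
      then show ?thesis using assms Old z by (auto simp: models_T_def old card_old)
    next
      case (U i)
      then show ?thesis using z by (auto simp: cls_U)
    next
      case (V i)
      then have "i < n" using z by (auto simp: node_struct_def)
      then show ?thesis using z V cls_V by auto
    qed
  qed
  then show ?thesis
    using assms struct equiv inf by (auto simp: models_T_def)
qed

lemma potentialist_system_tree_system:
  assumes "models_T N"
  shows "potentialist_system (tree_system N \<alpha>)"
proof -
  have emb: "is_embedding (node_struct N m) (node_struct N n)
      (restrict id (elems (node_struct N m)))" if "m \<le> n" for m n
    using elems_node_struct_mono[OF that, of N] rel_node_struct_restrict[OF that, of _ N]
    by (auto simp: is_embedding_def inj_on_def)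
  have comp: "compose (elems (node_struct N m)) (restrict id (elems (node_struct N n)))
      (restrict id (elems (node_struct N m))) = restrict id (elems (node_struct N m))"
    if "m \<le> n" for m n
    using elems_node_struct_mono[OF that, of N] by (auto simp: compose_def fun_eq_iff)
  show ?thesis
    using models_T_node_struct[OF assms] emb[OF prefix_length_le] comp[OF prefix_length_le]
    by (auto simp: potentialist_system_def tree_system_def models_T_def
        intro: prefix_order.trans split: if_splits)
qed

lemma potentialist_system_disjoint_union:
  assumes "\<And>i. potentialist_system (S i)"
  shows "potentialist_system (disjoint_union S)"
  using assms
  by (auto simp: potentialist_system_def disjoint_union_def split: if_splits)

end

theory Submission
  imports Defs
begin

text \<open>
  A node of \<open>X\<^sub>\<alpha>\<close> has as its rank the ordinal \<open>\<beta>\<close> for which the tree above it is a copy of \<open>X\<^sub>\<beta>\<close>,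
  so the root has rank \<open>\<alpha>\<close>. The modal language can express that the rank is at least \<open>\<beta>\<close>, by
  recursion on \<open>\<beta>\<close>: for every \<open>\<gamma> < \<beta>\<close> it must be possible to move strictly upwards to a world of
  rank at least \<open>\<gamma>\<close>. The modality alone cannot tell a strict move from the identity embedding;
  the structures can. Going from height \<open>n\<close> to a greater height turns the class of \<open>u\<^sub>n\<close>
  from a singleton into a pair, and no singleton class grows without a change of world. So a strict
  move is one after which some element, alone in its class before, has a partner. The resulting
  sentences (lemma \<open>sat_rank_sentence\<close>) tell the roots of any two of the systems apart.

  For the second part, a bisimulation preserves satisfaction of all formulas (lemma
  \<open>bisimulation_preserves_sat\<close>), and passing to a disjoint union does not affect satisfaction. A
  bitotal bisimulation relates each root, with the empty tuple, to some world of the other system;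
  two roots related to the same world would have the same theory. Hence the other system
  has at least as many worlds as there are ordinals, so its worlds do not form a set.
\<close>

section \<open>Binary conjunction\<close>

text \<open>
  Conjunctions are indexed by ordinals, so a binary one needs two distinct ordinals, here an
  arbitrary pair. They exist once the type of ordinals is infinite.
\<close>

definition index_pair :: "'o \<times> 'o" where
  "index_pair = (SOME p. fst p \<noteq> snd p)"

definition And :: "'o fm \<Rightarrow> 'o fm \<Rightarrow> 'o fm" where
  "And p q = Conj {fst index_pair, snd index_pair} (\<lambda>i. if i = fst index_pair then p else q)"

lemma infinite_ordinals:
  "class_of_ordinals TYPE('o::wellorder) \<Longrightarrow> infinite (UNIV :: 'o set)"
  by (auto simp: class_of_ordinals_def intro: countable_finite)

lemma index_pair_distinct:
  assumes "infinite (UNIV :: 'o set)"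
  shows "fst (index_pair :: 'o \<times> 'o) \<noteq> snd index_pair"
proof -
  obtain a :: 'o where True by simp
  obtain b where "b \<noteq> a"
    using ex_new_if_finite[OF assms, of "{a}"] by auto
  then have "\<exists>p :: 'o \<times> 'o. fst p \<noteq> snd p"
    by (intro exI[of _ "(a, b)"]) simp
  then show ?thesis
    unfolding index_pair_def by (rule someI_ex)
qed

lemma sat_And:
  assumes "infinite (UNIV :: 'o set)"
  shows "sat S w e (And p q :: 'o fm) \<longleftrightarrow> sat S w e p \<and> sat S w e q"
  using index_pair_distinct[OF assms] by (auto simp: And_def)

lemma free_vars_And:
  assumes "infinite (UNIV :: 'o set)"
  shows "free_vars (And p q :: 'o fm) = free_vars p \<union> free_vars q"
  using index_pair_distinct[OF assms] by (auto simp: And_def)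

lemma is_formula_And:
  assumes "infinite (UNIV :: 'o set)"
    and "finite (free_vars p)" "finite (free_vars q)"
  shows "is_formula (And p q :: 'o fm) \<longleftrightarrow> is_formula p \<and> is_formula q"
  using index_pair_distinct[OF assms(1)] assms
  by (auto simp: And_def small_def finite_lesspoll_infinite)


section \<open>Sentences expressing the rank of a node\<close>

definition has_partner :: "'o fm" where
  "has_partner = Exists 1 (And (Atom (Related 0 1)) (Neg (Atom (Equal 0 1))))"

text \<open>
  For each \<open>\<gamma> < \<beta>\<close> some element without a partner has one in a larger world of rank at least \<open>\<gamma>\<close>;
  gaining the partner is what forces that world to be strictly larger. The case distinction on
  \<open>\<gamma> < \<beta>\<close> makes the recursion well-founded; its second branch lies outside the index set.
\<close>

function rank_sentence :: "'o::wellorder \<Rightarrow> 'o fm" where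
  "rank_sentence \<beta> = Conj {..<\<beta>}
     (\<lambda>\<gamma>. if \<gamma> < \<beta>
           then Exists 0 (And (Neg has_partner) (Dia (And has_partner (rank_sentence \<gamma>))))
           else has_partner)"
  by auto
termination
  by (relation "{(x, y). x < y}") (auto intro: wf)

declare rank_sentence.simps [simp del]

lemma free_vars_has_partner:
  "infinite (UNIV :: 'o set) \<Longrightarrow> free_vars (has_partner :: 'o fm) = {0}"
  by (auto simp: has_partner_def free_vars_And)

lemma is_formula_has_partner:
  "infinite (UNIV :: 'o set) \<Longrightarrow> is_formula (has_partner :: 'o fm)"
  by (simp add: has_partner_def is_formula_And)

lemma free_vars_rank_sentence:
  assumes "infinite (UNIV :: 'o::wellorder set)"
  shows "free_vars (rank_sentence (\<beta> :: 'o)) = {}"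
  by (induction \<beta> rule: less_induct)
    (subst rank_sentence.simps, simp add: free_vars_And[OF assms] free_vars_has_partner[OF assms])

lemma is_sentence_rank_sentence:
  assumes "class_of_ordinals TYPE('o::wellorder)"
  shows "is_sentence (rank_sentence (\<beta> :: 'o))"
proof -
  note inf = infinite_ordinals[OF assms]
  note fv = free_vars_And[OF inf] free_vars_has_partner[OF inf] free_vars_rank_sentence[OF inf]
  have "is_formula (rank_sentence \<beta>)"
  proof (induction \<beta> rule: less_induct)
    case (less \<beta>)
    have "small TYPE('o) {..<\<beta>}"
      using assms by (simp add: class_of_ordinals_def)
    with less show ?case
      by (subst rank_sentence.simps)
        (simp add: fv is_formula_And[OF inf] is_formula_has_partner[OF inf])
  qed
  then show ?thesis
    by (simp add: is_sentence_def free_vars_rank_sentence[OF inf])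
qed


section \<open>Ranks of nodes\<close>

definition node_rank :: "'o \<Rightarrow> 'o list \<Rightarrow> 'o" where
  "node_rank \<alpha> s = (if s = [] then \<alpha> else last s)"

lemma node_rank_strict_prefix:
  assumes "t \<in> tree \<alpha>" "strict_prefix s t"
  shows "node_rank \<alpha> t < node_rank \<alpha> s"
proof -
  obtain z zs where t: "t = s @ z # zs"
    using assms(2) by (auto elim: strict_prefixE')
  have "last t \<in> set (z # zs)"
    unfolding t by (metis last_appendR last_in_set list.distinct(1))
  then have "last t < (if s = [] then \<alpha> else last s)"
    using assms(1) by (auto simp: tree_def t sorted_wrt_append)
  then show ?thesis by (simp add: node_rank_def t)
qed

lemma tree_extend:
  assumes "s \<in> tree \<alpha>" "\<gamma> < node_rank \<alpha> s"
  shows "s @ [\<gamma>] \<in> tree \<alpha>"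
  using assms
  by (cases s rule: rev_cases) (auto simp: tree_def node_rank_def sorted_wrt_append)

lemma sat_has_partner:
  assumes "infinite (UNIV :: 'o::wellorder set)"
  shows "sat (tree_system N \<alpha>) s e (has_partner :: 'o fm) \<longleftrightarrow>
    (\<exists>c \<in> elems (node_struct N (length s)). (e 0, c) \<in> rel (node_struct N (length s)) \<and> e 0 \<noteq> c)"
  by (simp add: has_partner_def sat_And[OF assms] tree_system_def)

lemma sat_has_partner_U:
  assumes "infinite (UNIV :: 'o::wellorder set)" "e 0 = U n"
  shows "sat (tree_system N \<alpha>) s e (has_partner :: 'o fm) \<longleftrightarrow> n < length s"
  using assms(2) unfolding sat_has_partner[OF assms(1)] by (auto simp: node_struct_def)

lemma sat_Dia_tree_system:
  "sat (tree_system N \<alpha>) s e (Dia p) \<longleftrightarrow>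
    (\<exists>t\<in>tree \<alpha>. prefix s t \<and>
       sat (tree_system N \<alpha>) t (restrict id (elems (node_struct N (length s))) \<circ> e) p)"
  by (auto simp: tree_system_def)

text \<open>
  The assignment is arbitrary here, even with values outside the world: the only variables looked
  at are bound by quantifiers within the sentence.
\<close>

lemma sat_rank_sentence:
  assumes inf: "infinite (UNIV :: 'o::wellorder set)" and "s \<in> tree \<alpha>"
  shows "sat (tree_system N \<alpha>) s e (rank_sentence (\<beta> :: 'o)) \<longleftrightarrow> \<beta> \<le> node_rank \<alpha> s"
  using \<open>s \<in> tree \<alpha>\<close>
proof (induction \<beta> arbitrary: s e rule: less_induct)
  case (less \<beta>)
  let ?S = "tree_system N \<alpha>" and ?E = "elems (node_struct N (length s))"
  let ?step = "\<lambda>\<gamma>. Exists 0 (And (Neg has_partner) (Dia (And has_partner (rank_sentence \<gamma>))))"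
  have "sat ?S s e (?step \<gamma>) \<longleftrightarrow> \<gamma> < node_rank \<alpha> s" if "\<gamma> < \<beta>" for \<gamma>
  proof
    assume "sat ?S s e (?step \<gamma>)"
    then obtain c t where c: "c \<in> ?E" "\<not> sat ?S s (e(0 := c)) (has_partner :: 'o fm)"
      and t: "t \<in> tree \<alpha>" "prefix s t" "sat ?S t (restrict id ?E \<circ> e(0 := c)) (has_partner :: 'o fm)"
        "sat ?S t (restrict id ?E \<circ> e(0 := c)) (rank_sentence \<gamma>)"
      by (auto simp: sat_And[OF inf] sat_Dia_tree_system simp del: sat.simps(7))
        (auto simp: tree_system_def)
    have "s \<noteq> t"
      using c t(3) by (auto simp: sat_has_partner[OF inf])
    then have "node_rank \<alpha> t < node_rank \<alpha> s"
      using t by (intro node_rank_strict_prefix) auto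
    moreover have "\<gamma> \<le> node_rank \<alpha> t"
      using less.IH[OF that t(1)] t(4) by blast
    ultimately show "\<gamma> < node_rank \<alpha> s" by simp
  next
    assume "\<gamma> < node_rank \<alpha> s"
    then have t: "s @ [\<gamma>] \<in> tree \<alpha>"
      using less.prems by (rule tree_extend[rotated])
    \<comment> \<open>The class that grows on leaving height \<open>n\<close> is that of \<open>u\<^sub>n\<close>.\<close>
    let ?u = "U (length s) :: 'b elt" and ?e = "e(0 := U (length s))"
    have u: "?u \<in> ?E" by (simp add: node_struct_def)
    have "sat ?S (s @ [\<gamma>]) (restrict id ?E \<circ> ?e) (rank_sentence \<gamma>)"
      unfolding less.IH[OF that t] by (simp add: node_rank_def)
    then have "sat ?S s ?e (Dia (And has_partner (rank_sentence \<gamma>)))"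
      unfolding sat_Dia_tree_system using t u
      by (intro bexI[of _ "s @ [\<gamma>]"])
        (simp_all add: sat_And[OF inf] sat_has_partner_U[OF inf, of _ "length s"])
    moreover have "\<not> sat ?S s ?e (has_partner :: 'o fm)"
      by (simp add: sat_has_partner_U[OF inf, of _ "length s"])
    ultimately have "sat ?S s ?e (And (Neg has_partner) (Dia (And has_partner (rank_sentence \<gamma>))))"
      unfolding sat_And[OF inf] sat.simps(2) by blast
    moreover have "?u \<in> elems (str ?S s)" using u by (simp add: tree_system_def)
    ultimately show "sat ?S s e (?step \<gamma>)" unfolding sat.simps(5) by blast
  qed
  then have "sat ?S s e (rank_sentence \<beta>) \<longleftrightarrow> (\<forall>\<gamma><\<beta>. \<gamma> < node_rank \<alpha> s)"
    by (subst rank_sentence.simps) (simp add: Ball_def del: sat.simps(5))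
  also have "\<dots> \<longleftrightarrow> \<beta> \<le> node_rank \<alpha> s"
    by (meson leI less_le_trans order.irrefl)
  finally show ?case .
qed

lemma nil_in_tree: "[] \<in> tree \<alpha>"
  by (simp add: tree_def)

lemma ex_assignment_tree_system: "\<exists>e :: nat \<Rightarrow> _. range e \<subseteq> elems (str (tree_system N \<alpha>) s)"
  by (rule exI[of _ U]) (auto simp: tree_system_def node_struct_def)

lemma true_at_rank_sentence:
  fixes \<alpha> :: "'o::wellorder"
  assumes "infinite (UNIV :: 'o set)"
  shows "true_at (tree_system N \<alpha>) [] (rank_sentence \<beta>) \<longleftrightarrow> \<beta> \<le> \<alpha>"
  using ex_assignment_tree_system
  by (auto simp: true_at_def sat_rank_sentence[OF assms nil_in_tree] node_rank_def)


section \<open>Invariance of satisfaction\<close>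

lemma bex_embs_disjoint_union:
  "(\<exists>v\<in>worlds (disjoint_union S). \<exists>q\<in>embs (disjoint_union S) (i, w) v. P v q) \<longleftrightarrow>
    (\<exists>w'\<in>worlds (S i). \<exists>q\<in>embs (S i) w w'. P (i, w') q)"
proof -
  have "v \<in> worlds (disjoint_union S) \<and> (\<exists>q. q \<in> embs (disjoint_union S) (i, w) v \<and> P v q) \<longleftrightarrow>
      (\<exists>w'. v = (i, w') \<and> w' \<in> worlds (S i) \<and> (\<exists>q. q \<in> embs (S i) w w' \<and> P v q))" for v
    by (cases v) (auto simp: disjoint_union_def)
  then show ?thesis unfolding Bex_def by auto
qed

lemma ball_embs_disjoint_union:
  "(\<forall>v\<in>worlds (disjoint_union S). \<forall>q\<in>embs (disjoint_union S) (i, w) v. P v q) \<longleftrightarrow>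
    (\<forall>w'\<in>worlds (S i). \<forall>q\<in>embs (S i) w w'. P (i, w') q)"
  using bex_embs_disjoint_union[where P = "\<lambda>v q. \<not> P v q"] by blast

lemma sat_disjoint_union:
  assumes "w \<in> worlds (S i)"
  shows "sat (disjoint_union S) (i, w) e p \<longleftrightarrow> sat (S i) w e p"
  using assms
proof (induction p arbitrary: w e)
  case (Atom a)
  show ?case by (cases a) (simp_all add: disjoint_union_def)
next
  case (Dia p)
  then show ?case by (simp add: bex_embs_disjoint_union comp_def)
next
  case (Box p)
  then show ?case by (simp add: ball_embs_disjoint_union comp_def)
qed (simp_all add: disjoint_union_def)

text \<open>
  Tuples of related pairs only grow to the right, whereas a quantifier may reuse a variable. The
  function \<open>g\<close> records at which position of the tuples the current value of each variable is found;
  a quantifier redirects its variable to the newly appended entry.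
\<close>

lemma bisimulation_preserves_sat:
  assumes bis: "bisimulation S T R"
    and "((w, as), (v, bs)) \<in> R"
    and "\<And>x. x \<in> free_vars p \<Longrightarrow> g x < length as \<and> d x = as ! g x \<and> e x = bs ! g x"
  shows "sat S w d p \<longleftrightarrow> sat T v e p"
  using assms(2-)
proof (induction p arbitrary: w v as bs g d e)
  case (Atom a)
  have atoms: "atom_vars b \<subseteq> {..<length as} \<Longrightarrow>
      atom_holds (str S w) ((!) as) b \<longleftrightarrow> atom_holds (str T v) ((!) bs) b" for b
    using bis Atom.prems(1) unfolding bisimulation_def by blast
  show ?case
  proof (cases a)
    case (Equal i j)
    then show ?thesis using Atom.prems(2) atoms[of "Equal (g i) (g j)"] by simp
  next
    case (Related i j)
    then show ?thesis using Atom.prems(2) atoms[of "Related (g i) (g j)"] by simp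
  qed
next
  case (Neg p)
  have "sat S w d p \<longleftrightarrow> sat T v e p"
    by (rule Neg.IH[OF Neg.prems(1), of g]) (use Neg.prems(2) in simp)
  then show ?case by simp
next
  case (Conj I f)
  have "sat S w d (f i) \<longleftrightarrow> sat T v e (f i)" if "i \<in> I" for i
    by (rule Conj.IH[OF _ Conj.prems(1), of _ g]) (use Conj.prems(2) that in auto)
  then show ?case by simp
next
  case (Disj I f)
  have "sat S w d (f i) \<longleftrightarrow> sat T v e (f i)" if "i \<in> I" for i
    by (rule Disj.IH[OF _ Disj.prems(1), of _ g]) (use Disj.prems(2) that in auto)
  then show ?case by simp
next
  case (Exists x p)
  have len: "length as = length bs"
    using bis Exists.prems(1) unfolding bisimulation_def by blast
  have "sat S w (d(x := a)) p \<longleftrightarrow> sat T v (e(x := b)) p"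
    if "((w, as @ [a]), (v, bs @ [b])) \<in> R" for a b
    by (rule Exists.IH[OF that, of "g(x := length as)"])
      (use Exists.prems(2) len in \<open>auto simp: nth_append less_SucI\<close>)
  moreover have "\<forall>a\<in>elems (str S w). \<exists>b\<in>elems (str T v). ((w, as @ [a]), (v, bs @ [b])) \<in> R"
    and "\<forall>b\<in>elems (str T v). \<exists>a\<in>elems (str S w). ((w, as @ [a]), (v, bs @ [b])) \<in> R"
    using bis Exists.prems(1) unfolding bisimulation_def by blast+
  ultimately show ?case unfolding sat.simps by meson
next
  case (Forall x p)
  have len: "length as = length bs"
    using bis Forall.prems(1) unfolding bisimulation_def by blast
  have "sat S w (d(x := a)) p \<longleftrightarrow> sat T v (e(x := b)) p"
    if "((w, as @ [a]), (v, bs @ [b])) \<in> R" for a b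
    by (rule Forall.IH[OF that, of "g(x := length as)"])
      (use Forall.prems(2) len in \<open>auto simp: nth_append less_SucI\<close>)
  moreover have "\<forall>a\<in>elems (str S w). \<exists>b\<in>elems (str T v). ((w, as @ [a]), (v, bs @ [b])) \<in> R"
    and "\<forall>b\<in>elems (str T v). \<exists>a\<in>elems (str S w). ((w, as @ [a]), (v, bs @ [b])) \<in> R"
    using bis Forall.prems(1) unfolding bisimulation_def by blast+
  ultimately show ?case unfolding sat.simps by meson
next
  case (Dia p)
  have len: "length as = length bs"
    using bis Dia.prems(1) unfolding bisimulation_def by blast
  have "sat S w' (q \<circ> d) p \<longleftrightarrow> sat T v' (r \<circ> e) p"
    if "((w', map q as), (v', map r bs)) \<in> R" for w' q v' r
    by (rule Dia.IH[OF that, of g]) (use Dia.prems(2) len in auto)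
  moreover have "\<forall>w'\<in>worlds S. \<forall>q\<in>embs S w w'. \<exists>v'\<in>worlds T. \<exists>r\<in>embs T v v'.
      ((w', map q as), (v', map r bs)) \<in> R"
    and "\<forall>v'\<in>worlds T. \<forall>r\<in>embs T v v'. \<exists>w'\<in>worlds S. \<exists>q\<in>embs S w w'.
      ((w', map q as), (v', map r bs)) \<in> R"
    using bis Dia.prems(1) unfolding bisimulation_def by blast+
  ultimately show ?case unfolding sat.simps by meson
next
  case (Box p)
  have len: "length as = length bs"
    using bis Box.prems(1) unfolding bisimulation_def by blast
  have "sat S w' (q \<circ> d) p \<longleftrightarrow> sat T v' (r \<circ> e) p"
    if "((w', map q as), (v', map r bs)) \<in> R" for w' q v' r
    by (rule Box.IH[OF that, of g]) (use Box.prems(2) len in auto)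
  moreover have "\<forall>w'\<in>worlds S. \<forall>q\<in>embs S w w'. \<exists>v'\<in>worlds T. \<exists>r\<in>embs T v v'.
      ((w', map q as), (v', map r bs)) \<in> R"
    and "\<forall>v'\<in>worlds T. \<forall>r\<in>embs T v v'. \<exists>w'\<in>worlds S. \<exists>q\<in>embs S w w'.
      ((w', map q as), (v', map r bs)) \<in> R"
    using bis Box.prems(1) unfolding bisimulation_def by blast+
  ultimately show ?case unfolding sat.simps by meson
qed


section \<open>The systems over all ordinals\<close>

text \<open>
  Sending each ordinal to a world related to its root is injective, since that world
  decides every rank sentence.
\<close>

lemma bisimilar_to_union_imp_not_small:
  fixes T :: "('v, 'b) psystem"
  assumes inf: "infinite (UNIV :: 'o::wellorder set)"
    and "bitotally_bisimilar (disjoint_union (tree_system N :: 'o \<Rightarrow> ('o list, 'n elt) psystem)) T"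
  shows "\<not> small TYPE('o) (worlds T)"
proof
  assume small: "small TYPE('o) (worlds T)"
  let ?S = "disjoint_union (tree_system N :: 'o \<Rightarrow> ('o list, 'n elt) psystem)"
  obtain R where bis: "bisimulation ?S T R" and dom: "Domain R = pairs ?S"
    using assms(2) by (auto simp: bitotally_bisimilar_def)
  have "\<exists>v\<in>worlds T. (((\<alpha>, []), []), (v, [])) \<in> R" for \<alpha>
  proof -
    have "((\<alpha>, []), []) \<in> Domain R"
      unfolding dom by (simp add: pairs_def disjoint_union_def tree_system_def nil_in_tree)
    then obtain v bs where vbs: "(((\<alpha>, []), []), (v, bs)) \<in> R" by auto
    moreover have "bs = []" "v \<in> worlds T"
      using bis vbs by (fastforce simp: bisimulation_def pairs_def)+
    ultimately show ?thesis by blast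
  qed
  then obtain f where f: "\<And>\<alpha>. f \<alpha> \<in> worlds T" "\<And>\<alpha>. (((\<alpha>, []), []), (f \<alpha>, [])) \<in> R"
    by metis
  have rank: "sat T (f \<alpha>) e (rank_sentence \<beta>) \<longleftrightarrow> \<beta> \<le> \<alpha>" for \<alpha> \<beta> e
  proof -
    have "sat ?S (\<alpha>, []) U (rank_sentence \<beta>) \<longleftrightarrow> sat T (f \<alpha>) e (rank_sentence \<beta>)"
      using bisimulation_preserves_sat[OF bis f(2)] free_vars_rank_sentence[OF inf] by blast
    moreover have "sat ?S (\<alpha>, []) U (rank_sentence \<beta>) \<longleftrightarrow> \<beta> \<le> \<alpha>"
      using sat_rank_sentence[OF inf nil_in_tree] nil_in_tree[of \<alpha>]
      by (subst sat_disjoint_union) (auto simp: node_rank_def tree_system_def)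
    ultimately show ?thesis by simp
  qed
  have "inj f"
    by (rule injI) (metis rank order.antisym order.refl)
  then have "(UNIV :: 'o set) \<lesssim> worlds T"
    using f(1) by (auto simp: lepoll_def)
  then show False
    using small lesspoll_trans1 lesspoll_not_refl unfolding small_def by blast
qed

theorem theorem60:
  fixes N :: "'n struct"
  assumes "class_of_ordinals TYPE('o::wellorder)"
    and "models_T N" and "countable (elems N)"
  shows "(\<forall>\<alpha> \<beta> :: 'o. \<alpha> \<noteq> \<beta> \<longrightarrow>
            (theory_of (tree_system N \<alpha>) [] :: 'o fm set) \<noteq> theory_of (tree_system N \<beta>) [] \<and>
            (\<exists>p :: 'o fm. is_sentence p \<and>
               (true_at (tree_system N \<alpha>) [] p \<longleftrightarrow> \<not> true_at (tree_system N \<beta>) [] p))) \<and>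
         \<not> (\<exists>S :: ('v, 'b) psystem. potentialist_system S \<and> small TYPE('o) (worlds S) \<and>
              bitotally_bisimilar (disjoint_union (tree_system N :: 'o \<Rightarrow> ('o list, 'n elt) psystem)) S)"
proof (intro conjI allI impI notI)
  note inf = infinite_ordinals[OF assms(1)]
  note sentence = is_sentence_rank_sentence[OF assms(1)]
  fix \<alpha> \<beta> :: 'o
  assume "\<alpha> \<noteq> \<beta>"
  \<comment> \<open>The sentence for the larger ordinal holds only at the larger system.\<close>
  then have "true_at (tree_system N \<alpha>) [] (rank_sentence (max \<alpha> \<beta>)) \<longleftrightarrow>
      \<not> true_at (tree_system N \<beta>) [] (rank_sentence (max \<alpha> \<beta>))"
    by (auto simp: true_at_rank_sentence[OF inf] max_def)
  then show "\<exists>p :: 'o fm. is_sentence p \<and>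
      (true_at (tree_system N \<alpha>) [] p \<longleftrightarrow> \<not> true_at (tree_system N \<beta>) [] p)"
    using sentence by blast
  then show "False" if "(theory_of (tree_system N \<alpha>) [] :: 'o fm set) = theory_of (tree_system N \<beta>) []"
    using that unfolding theory_of_def by blast
next
  assume "\<exists>S :: ('v, 'b) psystem. potentialist_system S \<and> small TYPE('o) (worlds S) \<and>
    bitotally_bisimilar (disjoint_union (tree_system N :: 'o \<Rightarrow> ('o list, 'n elt) psystem)) S"
  then show False
    using bisimilar_to_union_imp_not_small[OF infinite_ordinals[OF assms(1)]] by blast
qed

end
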